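(* Let $$r_S=1+\frac{\sqrt[3]{-18+\sqrt{330}}}{6^{2/3}}-\frac{1}{\sqrt[3]{6(-18+\sqrt{330})}}\approx 0.164878$$ (the real root of $2r^3-6r^2+7r-1=0$ in $(0,1)$). The radius of close-to-convexity and the radius of starlikeness for the class of convex mappings in $\mathcal{S}_H^0$ are both at least $r_S$.
   Context: $\mathbb{D}=\{z\in\mathbb{C}:|z|<1\}$. $\mathcal{S}_H^0$ is the class of univalent (injective), orientation-preserving complex-valued harmonic functions $f=h+\overline{g}$ in $\mathbb{D}$, with $h(z)=z+\sum_{n\ge2}a_nz^n$ and $g(z)=\sum_{n\ge2}b_nz^n$ analytic in $\mathbb{D}$ (so $f(0)=0$, $f_z(0)=1$, $f_{\overline z}(0)=0$). Such an $f$ is a convex mapping if $f(\mathbb{D})$ is a convex domain. A domain $\Omega\subset\mathbb{C}$ is close-to-convex if $\mathbb{C}\setminus\Omega$ is a union of closed half-lines whose interiors (open half-lines) are pairwise disjoint. A harmonic function is close-to-convex (resp. starlike) in $|z|<r$ if it is univalent and sense-preserving there and maps that disk onto a close-to-convex domain (resp. a domain starlike with respect to the origin). The radius of close-to-convexity (resp. starlikeness) of a class is the largest $r\in(0,1]$ such that every $f$ in the class is close-to-convex (resp. starlike) in $|z|<\rho$ for all $0<\rho\le r$. *)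

theory Defs
  imports "HOL-Complex_Analysis.Complex_Analysis"
begin

abbreviation unit_disk :: "complex set" where
  "unit_disk \<equiv> ball 0 1"

text \<open>
  On a disk, a complex-valued function is harmonic iff it has the form \<open>h + cnj g\<close> with
  \<open>h\<close> and \<open>g\<close> analytic; both are unique up to additive constants. Then \<open>f\<^sub>z = h'\<close> and
  \<open>f\<close> differentiated with respect to the conjugate variable is \<open>cnj g'\<close>.
\<close>

definition harmonic_decomposition ::
    "complex set \<Rightarrow> (complex \<Rightarrow> complex) \<Rightarrow> (complex \<Rightarrow> complex) \<Rightarrow> (complex \<Rightarrow> complex) \<Rightarrow> bool" where
  "harmonic_decomposition S f h g \<longleftrightarrow>
     h holomorphic_on S \<and> g holomorphic_on S \<and> (\<forall>z\<in>S. f z = h z + cnj (g z))"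

text \<open>The Jacobian of \<open>h + cnj g\<close> is \<open>|h'|\<^sup>2 - |g'|\<^sup>2\<close>; sense-preserving means that it is positive.\<close>

definition positive_jacobian ::
    "complex set \<Rightarrow> (complex \<Rightarrow> complex) \<Rightarrow> (complex \<Rightarrow> complex) \<Rightarrow> bool" where
  "positive_jacobian S h g \<longleftrightarrow> (\<forall>z\<in>S. (cmod (deriv h z))\<^sup>2 - (cmod (deriv g z))\<^sup>2 > 0)"

definition sense_preserving_harmonic_on :: "complex set \<Rightarrow> (complex \<Rightarrow> complex) \<Rightarrow> bool" where
  "sense_preserving_harmonic_on S f \<longleftrightarrow>
     (\<exists>h g. harmonic_decomposition S f h g \<and> positive_jacobian S h g)"

text \<open>
  The values of \<open>h\<close>, \<open>g\<close> and their derivatives at \<open>0\<close> express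
  \<open>h(z) = z + (\<Sum>n\<ge>2. a\<^sub>n z^n)\<close> and \<open>g(z) = (\<Sum>n\<ge>2. b\<^sub>n z^n)\<close>.
  Values of \<open>f\<close> outside the unit disk are irrelevant.
\<close>

definition SH0 :: "(complex \<Rightarrow> complex) set" where
  "SH0 = {f. inj_on f unit_disk \<and>
     (\<exists>h g. harmonic_decomposition unit_disk f h g \<and> positive_jacobian unit_disk h g \<and>
            h 0 = 0 \<and> deriv h 0 = 1 \<and> g 0 = 0 \<and> deriv g 0 = 0)}"

definition planar_domain :: "complex set \<Rightarrow> bool" where
  "planar_domain \<Omega> \<longleftrightarrow> open \<Omega> \<and> connected \<Omega> \<and> \<Omega> \<noteq> {}"

definition convex_SH0 :: "(complex \<Rightarrow> complex) set" where
  "convex_SH0 = {f \<in> SH0. planar_domain (f ` unit_disk) \<and> convex (f ` unit_disk)}"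

definition closed_half_line :: "complex \<times> complex \<Rightarrow> complex set" where
  "closed_half_line = (\<lambda>(a, d). {a + of_real t * d | t. t \<ge> 0})"

definition open_half_line :: "complex \<times> complex \<Rightarrow> complex set" where
  "open_half_line = (\<lambda>(a, d). {a + of_real t * d | t. t > 0})"

text \<open>
  Half-lines are given by an endpoint and a unit direction, so that distinct pairs are
  distinct half-lines. The family is empty when the domain is the whole plane.
\<close>

definition close_to_convex_domain :: "complex set \<Rightarrow> bool" where
  "close_to_convex_domain \<Omega> \<longleftrightarrow> planar_domain \<Omega> \<and>
     (\<exists>L. (\<forall>(a, d)\<in>L. cmod d = 1) \<and>
          - \<Omega> = (\<Union>l\<in>L. closed_half_line l) \<and>
          pairwise (\<lambda>l m. disjnt (open_half_line l) (open_half_line m)) L)"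

text \<open>The library predicate \<^const>\<open>starlike\<close> does not fix the centre.\<close>

definition starlike_domain_origin :: "complex set \<Rightarrow> bool" where
  "starlike_domain_origin \<Omega> \<longleftrightarrow>
     planar_domain \<Omega> \<and> 0 \<in> \<Omega> \<and> (\<forall>w\<in>\<Omega>. closed_segment 0 w \<subseteq> \<Omega>)"

definition close_to_convex_in :: "real \<Rightarrow> (complex \<Rightarrow> complex) \<Rightarrow> bool" where
  "close_to_convex_in r f \<longleftrightarrow>
     inj_on f (ball 0 r) \<and> sense_preserving_harmonic_on (ball 0 r) f \<and>
     close_to_convex_domain (f ` ball 0 r)"

definition starlike_in :: "real \<Rightarrow> (complex \<Rightarrow> complex) \<Rightarrow> bool" where
  "starlike_in r f \<longleftrightarrow>
     inj_on f (ball 0 r) \<and> sense_preserving_harmonic_on (ball 0 r) f \<and>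
     starlike_domain_origin (f ` ball 0 r)"

definition admissible_radii ::
    "(real \<Rightarrow> (complex \<Rightarrow> complex) \<Rightarrow> bool) \<Rightarrow> (complex \<Rightarrow> complex) set \<Rightarrow> real set" where
  "admissible_radii P F = {r. 0 < r \<and> r \<le> 1 \<and> (\<forall>f\<in>F. \<forall>\<rho>. 0 < \<rho> \<and> \<rho> \<le> r \<longrightarrow> P \<rho> f)}"

text \<open>
  The largest admissible radius is taken as a supremum. For an empty set \<^const>\<open>Sup\<close> has no
  meaning on the reals, so a lower bound for the radius should come with an admissible radius.
\<close>

definition radius_of ::
    "(real \<Rightarrow> (complex \<Rightarrow> complex) \<Rightarrow> bool) \<Rightarrow> (complex \<Rightarrow> complex) set \<Rightarrow> real" where
  "radius_of P F = Sup (admissible_radii P F)"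

definition r_S :: real where
  "r_S = 1 + root 3 (-18 + sqrt 330) / 6 powr (2/3) - 1 / root 3 (6 * (-18 + sqrt 330))"

end

theory Submission
  imports Defs "HOL-Computational_Algebra.Fundamental_Theorem_Algebra"
begin

text \<open>
  For a convex harmonic mapping \<open>f = h + cnj g\<close> and a unimodular \<open>c\<close>, the analytic shear
  \<open>F = h - c\<^sup>2 g\<close> satisfies \<open>Im (cnj c F) = Im (cnj c f)\<close>: it differs from \<open>f\<close> only by a
  displacement in the direction \<open>c\<close>. Since \<open>f\<close> has a convex range, every shear is injective
  (\<open>inj_on_shear\<close>), by the argument of Clunie and Sheil-Small: along the preimage of a segment of
  direction \<open>c\<close> the coordinate of \<open>F\<close> in that direction is locally injective, hence monotone.
  So every shear is a normalized univalent function, and classical facts on such functions apply.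

  Univalent functions are starlike in small disks: if \<open>F\<close> is normalized and univalent in the unit
  disk, then \<open>Re (z F'(z) / F(z)) > 0\<close> for \<open>0 < |z| < 1/6\<close> (\<open>univalent_starlike_disk\<close>), and
  \<open>1/6\<close> exceeds \<open>r_S\<close>. Indeed the Koebe quarter theorem on the disk about \<open>z\<close> that has the origin
  on its boundary gives \<open>|z F'(z) / F(z)| \<le> 4\<close> for \<open>|z| < 1/2\<close>, and the Borel-Caratheodory inequality
  turns this bound into \<open>|arg (z F'(z) / F(z))| < 3/2\<close> for \<open>|z| < 1/6\<close>.

  Let \<open>0 < |z| < 1/6\<close> and let \<open>c\<close> be the direction of \<open>f z\<close>. Starlikeness of the shear of direction
  \<open>c\<close> provides a path from \<open>0\<close> to \<open>z\<close> in the disk of radius \<open>|z|\<close> that \<open>F\<close> maps onto the segment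
  from \<open>0\<close> to \<open>F z\<close>. Along this path \<open>f\<close> stays on the line through \<open>0\<close> and \<open>f z\<close>, so by the
  intermediate value theorem it covers the segment between them. Hence \<open>f\<close> maps every disk
  of radius at most \<open>1/6\<close> onto a starlike domain, and a bounded starlike domain is close-to-convex
  because its complement splits into radial half-lines.

  The quarter theorem is proved without areas. For univalent \<open>F\<close> let \<open>E\<close> be the set of all \<open>e\<close> for
  which \<open>e F\<close> omits the value \<open>1\<close>; the claim is that \<open>E\<close> lies in the disk of radius \<open>4\<close>. The
  \<open>m\<close>-th Taylor coefficient of \<open>1 / (1 - e F)\<close> is a monic polynomial of degree \<open>m\<close> in \<open>e\<close>, and
  on \<open>E\<close> Cauchy's estimate bounds it by a constant times \<open>s ^ -m\<close> for any \<open>s < 1\<close>. On the other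
  hand \<open>E\<close> meets every circle about \<open>0\<close> inside the one through a given element of modulus \<open>L\<close>, and a monic
  polynomial of degree \<open>m\<close> on such a set attains at least the modulus \<open>(L / 4) ^ m\<close>, as it would
  on an interval of length \<open>L\<close>.
\<close>

section \<open>The Koebe quarter theorem\<close>

text \<open>
  For unimodular \<open>u\<close> one has \<open>(1 + u)\<^sup>2 = (2 + 2 Re u) u\<close>, so \<open>u\<close> parametrizes the interval from
  \<open>0\<close> to \<open>L\<close> by \<open>L (1 + Re u) / 2\<close>, and each factor on the left has modulus
  \<open>4 / L\<close> times the distance between \<open>|e|\<close> and \<open>|x|\<close>.
\<close>

lemma circular_projection_factors:
  fixes M :: "complex multiset"
  assumes L: "L > 0" and u: "cmod u = 1" and e: "cmod e = L * (1 + Re u) / 2"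
  shows "cmod (\<Prod>x\<in>#M. (1 + u)^2 - of_real (4 * cmod x / L) * u)
       \<le> (4 / L) ^ size M * cmod (\<Prod>x\<in>#M. e - x)"
proof (induction M)
  case (add x M)
  have uu: "u * cnj u = 1"
    using u by (simp add: complex_norm_square [symmetric])
  have "(1 + u)^2 = of_real (2 + 2 * Re u) * u"
  proof -
    have "(1 + u)^2 = u * (u + cnj u) + 2 * u"
      using uu by (simp add: power2_eq_square algebra_simps)
    then show ?thesis by (simp add: complex_add_cnj algebra_simps)
  qed
  then have "(1 + u)^2 - of_real (4 * cmod x / L) * u
      = of_real (2 + 2 * Re u - 4 * cmod x / L) * u"
    by (simp add: algebra_simps)
  then have "cmod ((1 + u)^2 - of_real (4 * cmod x / L) * u) = \<bar>2 + 2 * Re u - 4 * cmod x / L\<bar>"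
    using u by (simp only: norm_mult norm_of_real) simp
  also have "2 + 2 * Re u - 4 * cmod x / L = 4 / L * (cmod e - cmod x)"
    using L by (simp add: e field_simps)
  also have "\<bar>\<dots>\<bar> = 4 / L * \<bar>cmod e - cmod x\<bar>"
    using L by (simp add: abs_mult del: times_divide_eq_left)
  also have "\<dots> \<le> 4 / L * cmod (e - x)"
    using L by (intro mult_left_mono norm_triangle_ineq3) auto
  finally have "cmod ((1 + u)^2 - of_real (4 * cmod x / L) * u)
      * cmod (\<Prod>x\<in>#M. (1 + u)^2 - of_real (4 * cmod x / L) * u)
    \<le> (4 / L * cmod (e - x)) * ((4 / L) ^ size M * cmod (\<Prod>x\<in>#M. e - x))"
    using L by (intro mult_mono add.IH) auto
  then show ?case
    by (simp add: norm_mult mult_ac)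
qed auto

text \<open>
  Replacing the zeros and the argument of \<open>p\<close> by their moduli never increases \<open>|p|\<close>, so it
  suffices to bound a monic polynomial with real zeros on the interval from \<open>0\<close> to \<open>L\<close>. There the
  substitution \<open>t = L (1 + u)\<^sup>2 / (4 u)\<close> turns it into a polynomial \<open>Q\<close> on the unit circle with
  \<open>Q 0 = 1\<close>, to which the maximum principle applies.
\<close>

lemma monic_poly_circular_projection:
  fixes p :: "complex poly"
  assumes L: "L > 0" and monic: "lead_coeff p = 1"
    and bound: "\<And>t. 0 \<le> t \<Longrightarrow> t \<le> L \<Longrightarrow> \<exists>e. cmod e = t \<and> cmod (poly p e) \<le> B"
  shows "(L / 4) ^ degree p \<le> B"
proof -
  define M where "M = proots p"
  have pM: "poly p e = (\<Prod>x\<in>#M. e - x)" for e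
  proof -
    have "p = (\<Prod>x\<in>#M. [:-x, 1:])"
      using complex_poly_decompose_multiset [of p] monic by (simp add: M_def)
    also have "poly \<dots> e = (\<Prod>x\<in>#M. e - x)"
      by (induction M) (auto simp: algebra_simps)
    finally show ?thesis .
  qed
  have size: "size M = degree p"
    by (simp add: M_def size_proots_complex)
  define Q where "Q = (\<lambda>u. \<Prod>x\<in>#M. (1 + u)^2 - complex_of_real (4 * cmod x / L) * u)"
  have holQ: "Q holomorphic_on S" for S
    unfolding Q_def by (induction M) (auto intro!: holomorphic_intros)
  have "cmod ((deriv ^^ 0) Q 0) \<le> fact 0 * ((4 / L) ^ degree p * B) / 1 ^ 0"
  proof (rule Cauchy_inequality)
    fix u assume "cmod (0 - u) = 1"
    then have u: "cmod u = 1" by simp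
    then have "\<bar>Re u\<bar> \<le> 1" using abs_Re_le_cmod [of u] by simp
    then have "0 \<le> L * (1 + Re u) / 2" "L * (1 + Re u) / 2 \<le> L"
      using L mult_left_mono [of "1 + Re u" 2 L] by (auto simp: abs_le_iff)
    then obtain e where e: "cmod e = L * (1 + Re u) / 2" "cmod (poly p e) \<le> B"
      using bound by blast
    have "cmod (Q u) \<le> (4 / L) ^ size M * cmod (poly p e)"
      unfolding Q_def pM by (rule circular_projection_factors [OF L u e(1)])
    also have "\<dots> \<le> (4 / L) ^ degree p * B"
      unfolding size using L e(2) by (intro mult_left_mono) auto
    finally show "cmod (Q u) \<le> (4 / L) ^ degree p * B" .
  qed (use holQ holomorphic_on_imp_continuous_on in auto)
  moreover have "Q 0 = 1"
    unfolding Q_def by (induction M) auto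
  ultimately have "1 \<le> (4 / L) ^ degree p * B" by simp
  then show ?thesis
    using L by (simp add: power_divide field_simps)
qed

text \<open>
  The geometric series in \<open>e f\<close> may be cut off after the power \<open>m\<close>, because \<open>f\<close> vanishes at \<open>0\<close>.
\<close>

lemma geometric_fps_nth:
  fixes f :: "complex fps"
  assumes f0: "f $ 0 = 0"
  shows "inverse (1 - fps_const e * f) $ m = (\<Sum>k\<le>m. (f ^ k $ m) * e ^ k)"
proof -
  define a where "a = fps_const e * f"
  have a0: "a $ 0 = 0" using f0 by (simp add: a_def)
  define I where "I = inverse (1 - a)"
  have I: "I * (1 - a) = 1"
    unfolding I_def by (rule inverse_mult_eq_1) (simp add: a0)
  have "(\<Sum>k\<le>m. a ^ k) = I * ((1 - a) * (\<Sum>k\<le>m. a ^ k))"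
    using I by (simp add: mult.assoc [symmetric])
  also have "\<dots> = I - I * a ^ Suc m"
    by (simp only: sum_gp_basic) (simp add: algebra_simps)
  finally have "I = (\<Sum>k\<le>m. a ^ k) + I * a ^ Suc m" by simp
  moreover have "(I * a ^ Suc m) $ m = 0"
    using startsby_zero_power_prefix [OF a0, of "Suc m"]
    by (auto simp: fps_mult_nth simp del: power_Suc intro!: sum.neutral)
  ultimately have "I $ m = (\<Sum>k\<le>m. a ^ k) $ m"
    by (metis add.right_neutral fps_add_nth)
  also have "\<dots> = (\<Sum>k\<le>m. (f ^ k $ m) * e ^ k)"
    by (simp add: fps_sum_nth a_def power_mult_distrib fps_const_power mult.commute)
  finally show ?thesis by (simp add: I_def a_def)
qed

text \<open>
  The range of \<open>F\<close> is simply connected, so it cannot contain a circle that winds around the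
  omitted value \<open>p\<close>.
\<close>

lemma omitted_value_on_circle:
  assumes hol: "F holomorphic_on ball 0 1" and inj: "inj_on F (ball 0 1)"
    and F0: "F 0 = 0" and p: "p \<notin> F ` ball 0 1" and R: "cmod p < R"
  obtains v where "cmod v = R" "v \<notin> F ` ball 0 1"
proof (rule ccontr)
  assume "\<not> thesis"
  with that have sub: "sphere 0 R \<subseteq> F ` ball 0 1"
    by (meson mem_sphere_0 subsetI)
  have R0: "R > 0" using R norm_ge_zero [of p] by linarith
  have "unit_disk homeomorphic F ` ball 0 1"
    using invariance_of_domain_homeomorphic
      [OF open_ball holomorphic_on_imp_continuous_on [OF hol] _ inj] by simp
  then have sc: "simply_connected (F ` ball 0 1)"
    using homeomorphic_simply_connected convex_imp_simply_connected convex_ball by blast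
  have "winding_number (circlepath 0 R) p = 0"
    using sub R0 by (intro simply_connected_imp_winding_number_zero [OF sc _ _ _ p]) auto
  moreover have "winding_number (circlepath 0 R) p = 1"
    using R R0 by (intro winding_number_circlepath) auto
  ultimately show False by simp
qed

text \<open>
  In terms of \<open>E\<close>, the range of \<open>F\<close> omits \<open>p\<close> exactly when \<open>1 / p\<close> is in \<open>E\<close>. If \<open>L = 1 / |p|\<close>
  exceeded \<open>4\<close>, the lower bound \<open>(L / 4) ^ m\<close> for the coefficient polynomials on \<open>E\<close> would
  outgrow their upper bound of order \<open>s ^ -m\<close>, for \<open>s < 1\<close> close enough to \<open>1\<close>.
\<close>

lemma koebe_quarter_normalized:
  assumes hol: "F holomorphic_on ball 0 1" and inj: "inj_on F (ball 0 1)"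
    and F0: "F 0 = 0" and F1: "deriv F 0 = 1" and p: "p \<notin> F ` ball 0 1"
  shows "1 \<le> 4 * cmod p"
proof (rule ccontr)
  assume "\<not> ?thesis"
  then have p4: "cmod p < 1/4" by simp
  have p0: "p \<noteq> 0" using p F0 by force
  define L where "L = 1 / cmod p"
  have L4: "L > 4" using p4 p0 by (simp add: L_def field_simps)
  define E where "E = {e. \<forall>z\<in>ball 0 1. e * F z \<noteq> 1}"
  \<comment> \<open>The connectedness of \<open>E\<close>, in the form that the circular projection needs.\<close>
  have E: "\<exists>e\<in>E. cmod e = t" if t: "0 \<le> t" "t \<le> L" for t
  proof -
    have inv: "inverse v \<in> E" if "v \<notin> F ` ball 0 1" for v
    proof -
      have "v \<noteq> 0" using that F0 by force
      then show ?thesis using that by (auto simp: E_def field_simps)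
    qed
    consider "t = 0" | "t = L" | "0 < t" "t < L" using t by linarith
    then show ?thesis
    proof cases
      case 1 then show ?thesis by (intro bexI [of _ 0]) (auto simp: E_def)
    next
      case 2 then show ?thesis using inv [OF p]
        by (intro bexI [of _ "inverse p"]) (auto simp: L_def norm_inverse divide_inverse)
    next
      case 3
      then have "cmod p < 1 / t" using p0 by (simp add: L_def field_simps)
      then obtain v where v: "cmod v = 1 / t" "v \<notin> F ` ball 0 1"
        using omitted_value_on_circle [OF hol inj F0 p] by blast
      then show ?thesis using inv [OF v(2)]
        by (intro bexI [of _ "inverse v"]) (auto simp: norm_inverse)
    qed
  qed
  \<comment> \<open>Any \<open>s\<close> strictly between \<open>4 / L\<close> and \<open>1\<close> would do.\<close>
  define s where "s = (1 + 4 / L) / 2"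
  have s: "0 < s" "s < 1" "L * s > 4" using L4 by (auto simp: s_def field_simps)
  have sub: "cball 0 s \<subseteq> ball (0::complex) 1" using s by auto
  have contF: "continuous_on (cball 0 s) F"
    using holomorphic_on_imp_continuous_on [OF hol] continuous_on_subset sub by blast
  \<comment> \<open>A bound uniform in \<open>e\<close>: a large \<open>e\<close> in \<open>E\<close> is the inverse of an omitted value, whose
      distance from the compact set \<open>F ` cball 0 s\<close> is bounded below; for a small \<open>e\<close> the
      product \<open>e F\<close> is small.\<close>
  obtain c where c: "c > 0" "\<And>e z. e \<in> E \<Longrightarrow> z \<in> cball 0 s \<Longrightarrow> c \<le> cmod (1 - e * F z)"
  proof -
    let ?K = "F ` cball 0 s"
    have comp: "compact ?K" using contF by (intro compact_continuous_image) auto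
    have "open (F ` ball 0 1)"
      using open_mapping_thm3 [OF hol open_ball inj] .
    then have "closed (- F ` ball 0 1)" by auto
    moreover have "?K \<inter> (- F ` ball 0 1) = {}" using sub by auto
    ultimately obtain \<delta> where \<delta>: "\<delta> > 0" "\<And>x y. x \<in> ?K \<Longrightarrow> y \<notin> F ` ball 0 1 \<Longrightarrow> \<delta> \<le> dist x y"
      using separate_compact_closed [OF comp] by (metis ComplI)
    obtain B where B: "B > 0" "\<And>x. x \<in> ?K \<Longrightarrow> cmod x \<le> B"
      using compact_imp_bounded [OF comp] by (meson bounded_pos)
    show ?thesis
    proof
      show "min (1/2) (\<delta> / (2 * B)) > 0" using \<delta> B by simp
      fix e z assume e: "e \<in> E" and z: "z \<in> cball (0::complex) s"
      have FB: "cmod (F z) \<le> B" using B z by blast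
      show "min (1/2) (\<delta> / (2 * B)) \<le> cmod (1 - e * F z)"
      proof (cases "cmod e * B \<le> 1/2")
        case True
        have "cmod (e * F z) \<le> cmod e * B"
          unfolding norm_mult using FB by (intro mult_left_mono) auto
        then have "cmod (e * F z) \<le> 1/2" using True by linarith
        then have "1/2 \<le> cmod (1 - e * F z)"
          using norm_triangle_ineq2 [of 1 "e * F z"] by simp
        then show ?thesis by simp
      next
        case False
        then have e0: "e \<noteq> 0" by auto
        then have "1 / e \<notin> F ` ball 0 1"
          using e by (auto simp: E_def field_simps)
        then have "\<delta> \<le> dist (F z) (1 / e)" using \<delta> z by blast
        then have "\<delta> * cmod e \<le> cmod (F z - 1 / e) * cmod e"
          by (intro mult_right_mono) (auto simp: dist_norm)
        also have "\<dots> = cmod (1 - e * F z)"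
          using e0 by (simp add: norm_mult [symmetric] norm_minus_commute algebra_simps)
        finally have "\<delta> * cmod e \<le> cmod (1 - e * F z)" .
        moreover have "\<delta> / (2 * B) \<le> \<delta> * cmod e"
        proof -
          have "\<delta> * (1/2) \<le> \<delta> * (cmod e * B)"
            using False \<delta> by (intro mult_left_mono) auto
          then show ?thesis using B by (simp add: field_simps)
        qed
        ultimately show ?thesis by simp
      qed
    qed
  qed
  define f where "f = fps_expansion F 0"
  have expF: "F has_fps_expansion f"
    unfolding f_def using hol by (intro has_fps_expansion_fps_expansion [of "ball 0 1"]) auto
  have f0: "f $ 0 = 0" and f1: "f $ 1 = 1"
    using fps_nth_fps_expansion [OF expF, of 0] fps_nth_fps_expansion [OF expF, of 1] F0 F1 by auto
  have growth: "(L * s / 4) ^ m \<le> 1 / c" for m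
  proof -
    \<comment> \<open>The coefficient of order \<open>m\<close> of \<open>1 / (1 - e F)\<close>, as a polynomial in \<open>e\<close>; it is monic because
        \<open>F z ^ m = z ^ m + \<dots>\<close>.\<close>
    define P where "P = (\<Sum>k\<le>m. monom (f ^ k $ m) k)"
    have P: "poly P e = inverse (1 - fps_const e * f) $ m" for e
      unfolding geometric_fps_nth [OF f0] P_def by (simp add: poly_sum poly_monom)
    have coeffP: "coeff P k = (if k \<le> m then f ^ k $ m else 0)" for k
      by (simp add: P_def coeff_sum coeff_monom)
    have cm: "coeff P m = 1"
      using startsby_zero_power_nth_same [OF f0, of m] by (simp add: coeffP f1 del: One_nat_def)
    have deg: "degree P = m"
    proof (rule antisym)
      show "degree P \<le> m" by (rule degree_le) (simp add: coeffP)
      show "m \<le> degree P" by (rule le_degree) (simp add: cm)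
    qed
    have bound: "cmod (poly P e) \<le> 1 / c / s ^ m" if e: "e \<in> E" for e
    proof -
      let ?G = "\<lambda>z. inverse (1 - e * F z)"
      have ne: "1 - e * F z \<noteq> 0" if "z \<in> ball 0 1" for z
        using e that by (auto simp: E_def)
      have holG: "?G holomorphic_on ball 0 1"
        using hol ne by (intro holomorphic_intros) auto
      have "?G has_fps_expansion inverse (1 - fps_const e * f)"
        using f0 by (intro fps_expansion_intros expF) auto
      then have "poly P e = (deriv ^^ m) ?G 0 / fact m"
        unfolding P by (rule fps_nth_fps_expansion)
      moreover have "cmod ((deriv ^^ m) ?G 0) \<le> fact m * (1 / c) / s ^ m"
      proof (rule Cauchy_inequality)
        show "?G holomorphic_on ball 0 s"
          using holG holomorphic_on_subset sub ball_subset_cball by blast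
        show "continuous_on (cball 0 s) ?G"
          using holomorphic_on_imp_continuous_on [OF holG] continuous_on_subset sub by blast
        fix z :: complex assume "cmod (0 - z) = s"
        then have "c \<le> cmod (1 - e * F z)" by (intro c(2) e) auto
        then show "cmod (?G z) \<le> 1 / c"
          using c(1) by (simp add: norm_inverse divide_inverse le_imp_inverse_le)
      qed (use s in auto)
      ultimately show ?thesis
        by (simp add: norm_divide divide_le_eq mult.commute)
    qed
    have "(L / 4) ^ degree P \<le> 1 / c / s ^ m"
    proof (rule monic_poly_circular_projection)
      show "L > 0" using L4 by simp
      show "lead_coeff P = 1" using deg cm by simp
      show "\<exists>e. cmod e = t \<and> cmod (poly P e) \<le> 1 / c / s ^ m" if "0 \<le> t" "t \<le> L" for t
        using E [OF that] bound by blast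
    qed
    then show ?thesis
      using s c by (simp add: deg power_divide power_mult_distrib field_simps)
  qed
  have "L * s / 4 > 1" using s by simp
  then obtain m where "1 / c < (L * s / 4) ^ m"
    using real_arch_pow by blast
  with growth [of m] show False by simp
qed

lemma koebe_quarter:
  assumes hol: "F holomorphic_on ball a r" and inj: "inj_on F (ball a r)"
    and r: "r > 0" and w: "w \<notin> F ` ball a r"
  shows "r * cmod (deriv F a) \<le> 4 * cmod (w - F a)"
proof -
  have d: "deriv F a \<noteq> 0"
    using holomorphic_injective_imp_regular [OF hol open_ball inj] r by simp
  define D where "D = of_real r * deriv F a"
  have D: "D \<noteq> 0" using d r by (simp add: D_def)
  define K where "K = (\<lambda>u. (F (a + of_real r * u) - F a) / D)"
  have mem: "a + of_real r * u \<in> ball a r" if "u \<in> ball 0 1" for u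
    using that r by (simp add: dist_norm norm_mult)
  have der: "(F has_field_derivative deriv F a) (at a)"
    using holomorphic_derivI [OF hol open_ball] r by simp
  have "(K has_field_derivative 1) (at 0)"
    unfolding K_def using D d r der
    by (auto intro!: derivative_eq_intros DERIV_chain' [where g = F] simp: D_def)
  then have "deriv K 0 = 1" by (rule DERIV_imp_deriv)
  moreover have "K holomorphic_on ball 0 1"
    unfolding K_def using mem D
    by (intro holomorphic_intros holomorphic_on_compose_gen [OF _ hol, unfolded o_def]) auto
  moreover have "inj_on K (ball 0 1)"
  proof (rule inj_onI)
    fix u v assume uv: "u \<in> ball 0 1" "v \<in> ball 0 1" "K u = K v"
    then have "F (a + of_real r * u) = F (a + of_real r * v)"
      using D by (simp add: K_def)
    then have "a + of_real r * u = a + of_real r * v"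
      using inj_onD [OF inj] mem uv by blast
    then show "u = v" using r by simp
  qed
  moreover have "K 0 = 0" by (simp add: K_def)
  moreover have "(w - F a) / D \<notin> K ` ball 0 1"
    using mem D w by (force simp: K_def)
  ultimately have "1 \<le> 4 * cmod ((w - F a) / D)"
    by (intro koebe_quarter_normalized)
  then show ?thesis
    using D r by (simp add: D_def norm_divide norm_mult field_simps)
qed

section \<open>Starlikeness of univalent functions in small disks\<close>

lemma pi_ge_3: "pi \<ge> 3"
proof -
  have "sin (pi / 6) \<le> pi / 6"
    by (rule sin_x_le_x) auto
  then show ?thesis by (simp add: sin_30)
qed

text \<open>
  The disk about \<open>z\<close> with radius \<open>|z|\<close> lies in the unit disk, and \<open>F\<close> omits the value \<open>0 = F 0\<close>
  in it. So the quarter theorem bounds \<open>|z| |F' z|\<close> by four times the distance from \<open>F z\<close> to \<open>0\<close>.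
\<close>

lemma log_derivative_bound:
  assumes hol: "F holomorphic_on ball 0 1" and inj: "inj_on F (ball 0 1)"
    and F0: "F 0 = 0" and z: "z \<noteq> 0" "cmod z < 1/2"
  shows "cmod (z * deriv F z) \<le> 4 * cmod (F z)"
proof -
  have sub: "ball z (cmod z) \<subseteq> ball 0 1"
  proof
    fix x assume "x \<in> ball z (cmod z)"
    then have "cmod (x - z) < cmod z" by (simp add: dist_norm norm_minus_commute)
    then show "x \<in> ball 0 1"
      using norm_triangle_ineq [of z "x - z"] z(2) by simp
  qed
  have "0 \<notin> F ` ball z (cmod z)"
  proof
    assume "0 \<in> F ` ball z (cmod z)"
    then obtain x where x: "x \<in> ball z (cmod z)" "F x = F 0" using F0 by auto
    then have "x = 0" using inj_onD [OF inj] sub by (metis centre_in_ball subsetD zero_less_one)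
    with x(1) show False by simp
  qed
  then have "cmod z * cmod (deriv F z) \<le> 4 * cmod (0 - F z)"
    using z by (intro koebe_quarter holomorphic_on_subset [OF hol sub] inj_on_subset [OF inj sub]) auto
  then show ?thesis by (simp add: norm_mult)
qed

text \<open>
  The Moebius transformation \<open>q / (2 A - q)\<close> maps the half-plane \<open>Re q < A\<close> to the unit disk and
  fixes \<open>0\<close>, so that the Schwarz lemma applies to it, after rescaling the disk.
\<close>

lemma borel_caratheodory_half_disk:
  assumes hol: "q holomorphic_on ball 0 (1/2)" and q0: "q 0 = 0"
    and re: "\<And>z. cmod z < 1/2 \<Longrightarrow> Re (q z) < A" and z: "cmod z < 1/2"
  shows "cmod (q z) * (1 - 2 * cmod z) \<le> 4 * A * cmod z"
proof -
  have A: "A > 0" using re [of 0] q0 by simp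
  have lt: "cmod (q z) < cmod (2 * of_real A - q z)" if "cmod z < 1/2" for z
  proof -
    have "cmod (2 * of_real A - q z)^2 - cmod (q z)^2 = 4 * A * (A - Re (q z))"
      unfolding cmod_power2 by (simp add: power2_eq_square algebra_simps)
    moreover have "\<dots> > 0" using A re [OF that] by simp
    ultimately have "cmod (q z)^2 < cmod (2 * of_real A - q z)^2" by linarith
    then show ?thesis by (rule power_less_imp_less_base) simp
  qed
  then have ne: "2 * of_real A - q z \<noteq> 0" if "cmod z < 1/2" for z
    using that norm_ge_zero [of "q z"] by (metis norm_zero not_less)
  define w where "w = (\<lambda>u. q (u / 2) / (2 * of_real A - q (u / 2)))"
  have hol2: "(\<lambda>u. q (u / 2)) holomorphic_on ball 0 1"
    by (intro holomorphic_on_compose_gen [OF _ hol, unfolded o_def] holomorphic_intros) auto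
  have "cmod (w (2 * z)) \<le> cmod (2 * z)"
  proof (rule Schwarz_Lemma)
    show "w holomorphic_on ball 0 1"
      unfolding w_def using ne by (intro holomorphic_intros hol2) auto
    show "cmod (w u) < 1" if "cmod u < 1" for u
      using lt [of "u / 2"] that by (auto simp: w_def norm_divide divide_less_eq)
  qed (use z q0 in \<open>auto simp: w_def\<close>)
  then have "cmod (q z) \<le> 2 * cmod z * cmod (2 * of_real A - q z)"
    using ne [OF z] by (simp add: w_def norm_mult norm_divide divide_le_eq)
  also have "cmod (2 * of_real A - q z) \<le> 2 * A + cmod (q z)"
    using norm_triangle_ineq4 [of "2 * of_real A" "q z"] A by (simp add: norm_mult)
  finally have "cmod (q z) \<le> 2 * cmod z * (2 * A + cmod (q z))"
    by (simp add: mult_left_mono)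
  then show ?thesis by (simp add: algebra_simps)
qed

text \<open>
  The function \<open>z F'(z) / F(z)\<close> extends to \<open>0\<close> with the value \<open>1\<close> and has no zeros, so it has a
  logarithm \<open>Q\<close> with \<open>Q 0 = 0\<close>. As its modulus is at most \<open>4 < exp (3/2)\<close> for \<open>|z| < 1/2\<close>, the
  Borel-Caratheodory inequality gives \<open>|Q z| \<le> 6 |z| / (1 - 2 |z|)\<close>, which is less than
  \<open>3/2 \<le> \<pi>/2\<close> for \<open>|z| < 1/6\<close>.
\<close>

lemma univalent_starlike_disk:
  assumes hol: "F holomorphic_on ball 0 1" and inj: "inj_on F (ball 0 1)"
    and F0: "F 0 = 0" and F1: "deriv F 0 = 1" and z: "z \<noteq> 0" "cmod z < 1/6"
  shows "Re (z * deriv F z / F z) > 0"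
proof -
  have sub: "ball 0 (1/2) \<subseteq> ball (0::complex) 1" by auto
  have reg: "deriv F u \<noteq> 0" if "u \<in> ball 0 1" for u
    using holomorphic_injective_imp_regular [OF hol open_ball inj that] .
  have Fne: "F u \<noteq> 0" if "u \<in> ball 0 1" "u \<noteq> 0" for u
    using inj_onD [OF inj, of u 0] that F0 by auto
  define \<phi> where "\<phi> = (\<lambda>u. if u = 0 then deriv F 0 else (F u - F 0) / (u - 0))"
  have hol\<phi>: "\<phi> holomorphic_on ball 0 1"
    unfolding \<phi>_def by (rule pole_lemma [OF hol]) simp
  have \<phi>ne: "\<phi> u \<noteq> 0" if "u \<in> ball 0 1" for u
    using Fne that F0 F1 by (auto simp: \<phi>_def)
  define p where "p = (\<lambda>u. deriv F u / \<phi> u)"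
  have holp: "p holomorphic_on ball 0 (1/2)"
    unfolding p_def using sub \<phi>ne
    by (intro holomorphic_intros holomorphic_on_subset [OF hol\<phi>]
        holomorphic_on_subset [OF holomorphic_deriv [OF hol]]) auto
  have pne: "p u \<noteq> 0" if "u \<in> ball 0 (1/2)" for u
    using reg \<phi>ne that sub by (auto simp: p_def)
  have p0: "p 0 = 1" using F1 by (simp add: p_def \<phi>_def)
  have pz: "p u = u * deriv F u / F u" if "u \<noteq> 0" for u
    using that F0 by (simp add: p_def \<phi>_def)
  have p4: "cmod (p u) \<le> 4" if "u \<in> ball 0 (1/2)" for u
  proof (cases "u = 0")
    case False
    then have "cmod (u * deriv F u) \<le> 4 * cmod (F u)"
      using that by (intro log_derivative_bound [OF hol inj F0]) auto
    then show ?thesis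
      using False Fne [of u] that by (simp add: pz norm_divide divide_le_eq)
  qed (simp add: p0)
  obtain q where q: "q holomorphic_on ball 0 (1/2)" "\<And>u. u \<in> ball 0 (1/2) \<Longrightarrow> p u = exp (q u)"
    using contractible_imp_holomorphic_log [OF holp convex_imp_contractible [OF convex_ball] pne]
    by metis
  define Q where "Q = (\<lambda>u. q u - q 0)"
  have Q: "p u = exp (Q u)" if "u \<in> ball 0 (1/2)" for u
  proof -
    have "exp (q 0) = 1" using q(2) [of 0] p0 by simp
    then show ?thesis using q(2) [OF that] by (simp add: Q_def exp_diff)
  qed
  have e4: "exp (3/2 :: real) > 4"
  proof -
    have "(1 + (3/2) / of_nat 12) ^ 12 \<le> exp (3/2 :: real)"
      by (rule exp_ge_one_plus_x_over_n_power_n) auto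
    then show ?thesis by (rule less_le_trans [rotated]) (simp add: power_numeral_reduce)
  qed
  have "cmod (Q z) * (1 - 2 * cmod z) \<le> 4 * (3/2) * cmod z"
  proof (rule borel_caratheodory_half_disk)
    show "Q holomorphic_on ball 0 (1/2)"
      unfolding Q_def by (intro holomorphic_intros q)
    show "Re (Q u) < 3/2" if "cmod u < 1/2" for u
    proof -
      have "exp (Re (Q u)) \<le> 4"
        using Q [of u] p4 [of u] that by simp
      with e4 have "exp (Re (Q u)) < exp (3/2)" by linarith
      then show ?thesis by simp
    qed
  qed (use z in \<open>auto simp: Q_def\<close>)
  also have "\<dots> < 3/2 * (1 - 2 * cmod z)"
    using z by simp
  finally have "cmod (Q z) < 3/2"
    by (rule mult_right_less_imp_less) (use z in simp)
  then have "\<bar>Im (Q z)\<bar> < pi / 2"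
    using abs_Im_le_cmod [of "Q z"] pi_ge_3 by linarith
  then have "cos (Im (Q z)) > 0"
    by (intro cos_gt_zero_pi) auto
  moreover have "Re (z * deriv F z / F z) = exp (Re (Q z)) * cos (Im (Q z))"
    using pz [OF z(1)] Q [of z] z(2) by (simp add: Re_exp [symmetric])
  ultimately show ?thesis by simp
qed

text \<open>
  Follow the segment from \<open>F z\<close> towards \<open>0\<close>. Its preimage moves inwards: decreasing the parameter,
  the preimage \<open>\<zeta>\<close> has the velocity \<open>- F \<zeta> / F' \<zeta>\<close>, and the condition on \<open>\<zeta> F' \<zeta> / F \<zeta>\<close>
  says that this vector points into the disk of radius \<open>|\<zeta>|\<close>. So there is no
  first point at which the segment leaves the image of the closed disk of radius \<open>|z|\<close>.
\<close>

lemma starlike_image_of_disk: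
  assumes hol: "F holomorphic_on ball 0 R" and inj: "inj_on F (ball 0 R)" and F0: "F 0 = 0"
    and star: "\<And>z. z \<noteq> 0 \<Longrightarrow> cmod z < R \<Longrightarrow> Re (z * deriv F z / F z) > 0"
    and z: "cmod z < R" and \<tau>: "0 \<le> \<tau>" "\<tau> \<le> 1"
  shows "of_real \<tau> * F z \<in> F ` cball 0 (cmod z)"
proof (rule ccontr)
  assume notin: "of_real \<tau> * F z \<notin> F ` cball 0 (cmod z)"
  define K where "K = F ` cball 0 (cmod z)"
  have cballR: "cball 0 (cmod z) \<subseteq> ball (0::complex) R" using z by auto
  have "compact K"
    unfolding K_def
    using holomorphic_on_imp_continuous_on [OF hol] continuous_on_subset cballR
    by (intro compact_continuous_image) auto
  then have clK: "closed K" by (rule compact_imp_closed)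
  define A where "A = {\<tau>..1} \<inter> (\<lambda>t. complex_of_real t * F z) -` K"
  have "closed A"
    unfolding A_def using clK
    by (intro closed_Int continuous_closed_vimage continuous_intros) auto
  then have "compact A"
    by (metis A_def closed_Int_compact compact_Icc inf.left_idem inf_commute)
  moreover have "1 \<in> A" using \<tau> by (auto simp: A_def K_def)
  \<comment> \<open>The smallest parameter above the missing one whose point is still in the image.\<close>
  ultimately obtain t where t: "t \<in> A" "\<And>s. s \<in> A \<Longrightarrow> t \<le> s"
    using compact_attains_inf [of A] by blast
  then obtain \<zeta> where \<zeta>: "cmod \<zeta> \<le> cmod z" "F \<zeta> = of_real t * F z"
    by (auto simp: A_def K_def)
  have "t \<noteq> \<tau>" using t(1) notin by (auto simp: A_def K_def)
  then have t\<tau>: "\<tau> < t" "t \<le> 1" using t(1) by (auto simp: A_def)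
  have "F z \<noteq> 0"
  proof
    assume "F z = 0"
    then have "of_real \<tau> * F z = F 0" using F0 by simp
    with notin show False by auto
  qed
  then have F\<zeta>: "F \<zeta> \<noteq> 0" using \<zeta> t\<tau> \<tau> by auto
  then have \<zeta>0: "\<zeta> \<noteq> 0" using F0 by auto
  have \<zeta>R: "\<zeta> \<in> ball 0 R" using \<zeta> z by auto
  obtain g where g: "g holomorphic_on F ` ball 0 R"
      "\<And>u. u \<in> ball 0 R \<Longrightarrow> deriv F u * deriv g (F u) = 1"
      "\<And>u. u \<in> ball 0 R \<Longrightarrow> g (F u) = u"
    using holomorphic_has_inverse [OF hol open_ball inj] by blast
  have opI: "open (F ` ball 0 R)"
    using open_mapping_thm3 [OF hol open_ball inj] .
  \<comment> \<open>The segment and its preimage near the point \<open>F \<zeta>\<close>, with \<open>s > 0\<close> in the direction of \<open>0\<close>.\<close>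
  define c where "c = (\<lambda>s::real. of_real (1 - s) * F \<zeta>)"
  define \<gamma> where "\<gamma> = (\<lambda>s. g (c s))"
  define D where "D = - F \<zeta> / deriv F \<zeta>"
  have derg: "(g has_field_derivative 1 / deriv F \<zeta>) (at (c 0))"
  proof -
    have "(g has_field_derivative deriv g (F \<zeta>)) (at (F \<zeta>))"
      using holomorphic_derivI [OF g(1) opI] \<zeta>R by blast
    moreover have "deriv g (F \<zeta>) = 1 / deriv F \<zeta>"
      using g(2) [OF \<zeta>R] by (metis mult_zero_left nonzero_eq_divide_eq mult.commute zero_neq_one)
    ultimately show ?thesis by (simp add: c_def)
  qed
  have derc: "(c has_vector_derivative - F \<zeta>) (at 0)"
    unfolding c_def by (auto intro!: derivative_eq_intros simp: has_vector_derivative_def scaleR_conv_of_real)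
  have der\<gamma>: "(\<gamma> has_vector_derivative D) (at 0)"
    using field_vector_diff_chain_at [OF derc derg] by (simp add: \<gamma>_def o_def D_def)
  have \<gamma>0: "\<gamma> 0 = \<zeta>" using g(3) [OF \<zeta>R] by (simp add: \<gamma>_def c_def)
  have "((\<lambda>s. (Re (\<gamma> s))^2 + (Im (\<gamma> s))^2) has_real_derivative
      2 * Re (cnj \<zeta> * D)) (at 0)"
  proof -
    have "((\<lambda>s. Re (\<gamma> s)) has_real_derivative Re D) (at 0)"
      "((\<lambda>s. Im (\<gamma> s)) has_real_derivative Im D) (at 0)"
      using bounded_linear.has_vector_derivative [OF bounded_linear_Re der\<gamma>]
        bounded_linear.has_vector_derivative [OF bounded_linear_Im der\<gamma>]
      by (simp_all add: has_real_derivative_iff_has_vector_derivative)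
    from DERIV_add [OF DERIV_power [OF this(1), of 2] DERIV_power [OF this(2), of 2]]
    show ?thesis by (simp add: \<gamma>0 algebra_simps)
  qed
  moreover have "2 * Re (cnj \<zeta> * D) < 0"
  proof -
    define P where "P = \<zeta> * deriv F \<zeta> / F \<zeta>"
    have "Re P > 0" unfolding P_def using \<zeta>0 \<zeta>R by (intro star) auto
    then have "Re (inverse P) > 0" by (simp add: sum_power2_gt_zero_iff)
    moreover have "cnj \<zeta> * D = - (of_real ((cmod \<zeta>)^2) * inverse P)"
      unfolding D_def P_def complex_norm_square using \<zeta>0 by (simp add: field_simps)
    then have "Re (cnj \<zeta> * D) = - ((cmod \<zeta>)^2 * Re (inverse P))"
      by (simp del: of_real_power)
    moreover have "(cmod \<zeta>)^2 > 0" using \<zeta>0 by simp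
    ultimately show ?thesis by (metis mult_pos_pos mult_pos_neg neg_less_0_iff_less zero_less_numeral)
  qed
  ultimately obtain d where d: "d > 0" "\<And>h. 0 < h \<Longrightarrow> h < d \<Longrightarrow>
      (Re (\<gamma> (0 + h)))^2 + (Im (\<gamma> (0 + h)))^2 < (Re (\<gamma> 0))^2 + (Im (\<gamma> 0))^2"
    using DERIV_neg_dec_right by blast
  have "continuous (at 0) c"
    using derc has_vector_derivative_continuous by blast
  then have "eventually (\<lambda>s. c s \<in> F ` ball 0 R) (at 0)"
    using opI \<zeta>R by (intro topological_tendstoD) (auto simp: continuous_at c_def)
  then obtain d' where d': "d' > 0" "\<And>s. 0 < s \<Longrightarrow> s < d' \<Longrightarrow> c s \<in> F ` ball 0 R"
    unfolding eventually_at by (auto simp: dist_real_def)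
  \<comment> \<open>A step that is short enough to decrease the modulus of the preimage, to stay in the range of
      \<open>F\<close>, and not to pass the missing point.\<close>
  define h where "h = min (min d d' / 2) (min ((t - \<tau>) / 2) (1/2))"
  have h: "0 < h" "h < d" "h < d'" "h \<le> t - \<tau>" "h < 1"
    using d(1) d'(1) t\<tau> by (auto simp: h_def min_def)
  have "(cmod (\<gamma> h))^2 < (cmod \<zeta>)^2"
    using d(2) [of h] h \<gamma>0 by (simp add: cmod_power2)
  then have "cmod (\<gamma> h) < cmod \<zeta>" by (rule power_less_imp_less_base) simp
  then have "\<gamma> h \<in> cball 0 (cmod z)" using \<zeta> by simp
  moreover have "F (\<gamma> h) = c h"
    using d'(2) [of h] h g(3) by (auto simp: \<gamma>_def)
  ultimately have "c h \<in> K" unfolding K_def by (metis imageI)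
  then have "of_real ((1 - h) * t) * F z \<in> K"
    using \<zeta> by (simp add: c_def mult.assoc)
  moreover have "\<tau> \<le> (1 - h) * t"
  proof -
    have "h * t \<le> h * 1" using t\<tau> h by (intro mult_left_mono) auto
    then have "h * t \<le> t - \<tau>" using h(4) by linarith
    then show ?thesis by (simp add: algebra_simps)
  qed
  moreover have ht: "h * t > 0" using h t\<tau> \<tau> by simp
  ultimately have "(1 - h) * t \<in> A"
    using t\<tau> unfolding A_def by (simp add: algebra_simps)
  then show False using t(2) ht by (fastforce simp: algebra_simps)
qed

section \<open>Shears of convex harmonic mappings\<close>

lemma harmonic_decomposition_imp_continuous:
  assumes "harmonic_decomposition S f h g"
  shows "continuous_on S f"
proof -
  have "continuous_on S (\<lambda>z. h z + cnj (g z))"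
    using assms unfolding harmonic_decomposition_def
    by (intro continuous_intros holomorphic_on_imp_continuous_on) auto
  then show ?thesis
    by (rule continuous_on_eq) (use assms in \<open>auto simp: harmonic_decomposition_def\<close>)
qed

definition shear :: "complex \<Rightarrow> (complex \<Rightarrow> complex) \<Rightarrow> (complex \<Rightarrow> complex) \<Rightarrow> complex \<Rightarrow> complex" where
  "shear c h g = (\<lambda>z. h z - c^2 * g z)"

text \<open>
  Since \<open>cnj c * c\<^sup>2 = c\<close>, passing from \<open>f\<close> to the shear replaces the summand \<open>cnj (c g)\<close> of
  \<open>cnj c f\<close> by \<open>- c g\<close>, which has the same imaginary part.
\<close>

lemma Im_shear:
  assumes "cmod c = 1"
  shows "Im (cnj c * shear c h g z) = Im (cnj c * (h z + cnj (g z)))"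
proof -
  have "cnj c * c = 1"
    using assms by (simp add: mult.commute complex_norm_square [symmetric])
  then have "cnj c * c^2 = c"
    by (simp add: power2_eq_square mult.assoc [symmetric])
  then have "cnj c * shear c h g z = cnj c * h z - c * g z"
    by (simp add: shear_def right_diff_distrib mult.assoc [symmetric])
  then have "Im (cnj c * shear c h g z) = Im (cnj c * h z) - Im (c * g z)"
    by (simp only: minus_complex.sel)
  also have "\<dots> = Im (cnj c * (h z + cnj (g z)))"
    by (simp add: algebra_simps)
  finally show ?thesis .
qed

lemma unimodular_parts_eqI:
  assumes "cmod c = 1" "Im (cnj c * a) = Im (cnj c * b)" "Re (cnj c * a) = Re (cnj c * b)"
  shows "a = b"
proof -
  have "cnj c * a = cnj c * b" using assms by (intro complex_eqI) auto
  then show ?thesis using assms(1) by auto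
qed

text \<open>
  A function as in Rolle's theorem has an extremum at an interior point, and near that point it
  is not strictly monotone.
\<close>

lemma not_inj_near_interior_point:
  fixes \<Lambda> :: "real \<Rightarrow> real"
  assumes cont: "continuous_on {0..1} \<Lambda>" and eq: "\<Lambda> 0 = \<Lambda> 1"
  obtains t where "0 < t" "t < 1" "\<And>\<delta>. \<delta> > 0 \<Longrightarrow> \<not> inj_on \<Lambda> ({0..1} \<inter> {t - \<delta>..t + \<delta>})"
proof -
  obtain t where t: "0 < t" "t < 1"
    and ext: "(\<forall>s\<in>{0..1}. \<Lambda> s \<le> \<Lambda> t) \<or> (\<forall>s\<in>{0..1}. \<Lambda> t \<le> \<Lambda> s)"
  proof -
    obtain a where a: "a \<in> {0..1}" "\<And>s. s \<in> {0..1} \<Longrightarrow> \<Lambda> s \<le> \<Lambda> a"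
      using continuous_attains_sup [OF compact_Icc _ cont] by auto
    obtain b where b: "b \<in> {0..1}" "\<And>s. s \<in> {0..1} \<Longrightarrow> \<Lambda> b \<le> \<Lambda> s"
      using continuous_attains_inf [OF compact_Icc _ cont] by auto
    consider "0 < a" "a < 1" | "0 < b" "b < 1" | "a \<in> {0, 1}" "b \<in> {0, 1}"
      using a(1) b(1) by fastforce
    then show ?thesis
    proof cases
      case 1 then show ?thesis using a that by blast
    next
      case 2 then show ?thesis using b that by blast
    next
      case 3
      then have "\<Lambda> a = \<Lambda> 0" "\<Lambda> b = \<Lambda> 0" using eq by auto
      then have "\<Lambda> s \<le> \<Lambda> (1/2)" if "s \<in> {0..1}" for s
        using a(2) [OF that] b(2) [of "1/2"] by auto
      then show ?thesis using that [of "1/2"] by auto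
    qed
  qed
  show ?thesis
  proof (rule that [OF t], rule notI)
    fix \<delta> :: real assume "\<delta> > 0" and inj: "inj_on \<Lambda> ({0..1} \<inter> {t - \<delta>..t + \<delta>})"
    define \<epsilon> where "\<epsilon> = min \<delta> (min t (1 - t))"
    have \<epsilon>: "\<epsilon> > 0" "{t - \<epsilon>..t + \<epsilon>} \<subseteq> {0..1} \<inter> {t - \<delta>..t + \<delta>}"
      using \<open>\<delta> > 0\<close> t by (auto simp: \<epsilon>_def)
    have "(\<Lambda> (t - \<epsilon>) < \<Lambda> t \<and> \<Lambda> t < \<Lambda> (t + \<epsilon>)) \<or> (\<Lambda> (t + \<epsilon>) < \<Lambda> t \<and> \<Lambda> t < \<Lambda> (t - \<epsilon>))"
      using \<epsilon> by (intro continuous_inj_imp_mono continuous_on_subset [OF cont] inj_on_subset [OF inj]) auto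
    moreover have "t - \<epsilon> \<in> {0..1}" "t + \<epsilon> \<in> {0..1}" using \<epsilon> by auto
    ultimately show False using ext by (meson not_less)
  qed
qed

text \<open>
  If the shear takes the same value at two points, then their images under \<open>f\<close> lie on a line of direction \<open>c\<close>,
  and the segment between them lies in the convex range of \<open>f\<close>. On the preimage of this segment
  only the coordinate \<open>\<Lambda>\<close> of the shear in the direction \<open>c\<close> varies. It returns to its initial
  value, so it is not locally injective; but the shear is, because \<open>|g'| < |h'|\<close> makes
  its derivative nonzero.
\<close>

lemma inj_on_shear:
  assumes inj: "inj_on f (ball 0 1)" and dec: "harmonic_decomposition (ball 0 1) f h g"
    and jac: "positive_jacobian (ball 0 1) h g" and conv: "convex (f ` ball 0 1)"
    and c: "cmod c = 1"
  shows "inj_on (shear c h g) (ball 0 1)"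
proof (rule inj_onI, rule ccontr)
  let ?F = "shear c h g"
  fix z1 z2 :: complex
  assume z: "z1 \<in> ball 0 1" "z2 \<in> ball 0 1" and eq: "?F z1 = ?F z2" and "z1 \<noteq> z2"
  have hol: "h holomorphic_on ball 0 1" "g holomorphic_on ball 0 1"
    and f: "\<And>z. z \<in> ball 0 1 \<Longrightarrow> f z = h z + cnj (g z)"
    using dec by (auto simp: harmonic_decomposition_def)
  have holF: "?F holomorphic_on ball 0 1"
    unfolding shear_def using hol by (intro holomorphic_intros)
  have regF: "deriv ?F z \<noteq> 0" if z: "z \<in> ball 0 1" for z
  proof
    assume "deriv ?F z = 0"
    moreover have "deriv ?F z = deriv h z - c^2 * deriv g z"
      unfolding shear_def
      by (intro DERIV_imp_deriv derivative_intros holomorphic_derivI [OF hol(1) open_ball z])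
        (rule DERIV_cmult holomorphic_derivI [OF hol(2) open_ball z])+
    ultimately have "cmod (deriv h z) = cmod (deriv g z)"
      using c by (metis eq_iff_diff_eq_0 mult_1 norm_mult norm_power power_one)
    moreover have "(cmod (deriv h z))^2 - (cmod (deriv g z))^2 > 0"
      using jac z unfolding positive_jacobian_def by blast
    ultimately show False by simp
  qed
  have ImF: "Im (cnj c * ?F z) = Im (cnj c * f z)" if "z \<in> ball 0 1" for z
    unfolding f [OF that] by (rule Im_shear [OF c])
  have contf: "continuous_on (ball 0 1) f"
    using harmonic_decomposition_imp_continuous [OF dec] .
  obtain G where G: "homeomorphism (ball 0 1) (f ` ball 0 1) f G"
    using invariance_of_domain_homeomorphism [OF open_ball contf _ inj] by auto
  then have Gf: "G (f z) = z" if "z \<in> ball 0 1" for z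
    using that unfolding homeomorphism_def by blast
  have contG: "continuous_on (f ` ball 0 1) G"
    using G unfolding homeomorphism_def by blast
  define \<sigma> where "\<sigma> = (\<lambda>t. f z1 + of_real t * (f z2 - f z1))"
  define \<gamma> where "\<gamma> = (\<lambda>t. G (\<sigma> t))"
  define \<Lambda> where "\<Lambda> = (\<lambda>t. Re (cnj c * ?F (\<gamma> t)))"
  have \<sigma>: "\<sigma> t \<in> f ` ball 0 1" if "t \<in> {0..1}" for t
  proof -
    have "\<sigma> t = (1 - t) *\<^sub>R f z1 + t *\<^sub>R f z2"
      by (simp add: \<sigma>_def scaleR_conv_of_real algebra_simps)
    then show ?thesis
      using that z by (auto intro!: convexD [OF conv])
  qed
  have \<gamma>: "\<gamma> t \<in> ball 0 1" "f (\<gamma> t) = \<sigma> t" if t: "t \<in> {0..1}" for t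
  proof -
    obtain u where u: "u \<in> ball 0 1" "\<sigma> t = f u" using \<sigma> [OF t] by blast
    then show "\<gamma> t \<in> ball 0 1" "f (\<gamma> t) = \<sigma> t" by (simp_all only: \<gamma>_def Gf)
  qed
  have \<gamma>01: "\<gamma> 0 = z1" "\<gamma> 1 = z2"
    using Gf z by (simp_all add: \<gamma>_def \<sigma>_def)
  have cont\<gamma>: "continuous_on {0..1} \<gamma>"
    unfolding \<gamma>_def
  proof (rule continuous_on_compose2 [OF contG])
    show "continuous_on {0..1} \<sigma>"
      unfolding \<sigma>_def by (intro continuous_intros)
    show "\<sigma> ` {0..1} \<subseteq> f ` ball 0 1" using \<sigma> by blast
  qed
  have inj\<gamma>: "s = t" if "s \<in> {0..1}" "t \<in> {0..1}" "\<gamma> s = \<gamma> t" for s t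
  proof -
    have "\<sigma> s = \<sigma> t" using \<gamma>(2) that by metis
    moreover have "f z2 \<noteq> f z1" using inj_onD [OF inj] z \<open>z1 \<noteq> z2\<close> by metis
    ultimately show ?thesis by (simp add: \<sigma>_def)
  qed
  have Im\<gamma>: "Im (cnj c * ?F (\<gamma> t)) = Im (cnj c * f z1)" if "t \<in> {0..1}" for t
  proof -
    have "Im (cnj c * f z2) = Im (cnj c * f z1)"
      using ImF z eq by metis
    moreover have "cnj c * \<sigma> t = cnj c * f z1 + of_real t * (cnj c * f z2 - cnj c * f z1)"
      by (simp add: \<sigma>_def algebra_simps)
    ultimately have "Im (cnj c * \<sigma> t) = Im (cnj c * f z1)" by simp
    then show ?thesis using ImF \<gamma> that by metis
  qed
  have "continuous_on {0..1} \<Lambda>"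
    unfolding \<Lambda>_def
    by (intro continuous_intros continuous_on_compose2
        [OF holomorphic_on_imp_continuous_on [OF holF] cont\<gamma>]) (use \<gamma> in auto)
  moreover have "\<Lambda> 0 = \<Lambda> 1" using eq by (simp add: \<Lambda>_def \<gamma>01)
  ultimately obtain t where t: "0 < t" "t < 1"
    and noninj: "\<And>\<delta>. \<delta> > 0 \<Longrightarrow> \<not> inj_on \<Lambda> ({0..1} \<inter> {t - \<delta>..t + \<delta>})"
    using not_inj_near_interior_point by blast
  have tI: "t \<in> {0..1}" using t by simp
  obtain r where r: "r > 0" "inj_on ?F (ball (\<gamma> t) r)"
    using has_complex_derivative_locally_injective [OF holF \<gamma>(1) [OF tI] open_ball regF [OF \<gamma>(1) [OF tI]]]
    by blast
  obtain \<delta> where \<delta>: "\<delta> > 0" "\<And>s. s \<in> {0..1} \<Longrightarrow> dist s t < \<delta> \<Longrightarrow> dist (\<gamma> s) (\<gamma> t) < r"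
    using cont\<gamma> tI r(1) unfolding continuous_on_iff by metis
  have "inj_on \<Lambda> ({0..1} \<inter> {t - \<delta> / 2..t + \<delta> / 2})"
  proof (rule inj_onI)
    fix s s' assume s: "s \<in> {0..1} \<inter> {t - \<delta> / 2..t + \<delta> / 2}"
      and s': "s' \<in> {0..1} \<inter> {t - \<delta> / 2..t + \<delta> / 2}" and "\<Lambda> s = \<Lambda> s'"
    then have "?F (\<gamma> s) = ?F (\<gamma> s')"
      using Im\<gamma> by (intro unimodular_parts_eqI [OF c]) (auto simp: \<Lambda>_def)
    moreover have "\<gamma> s \<in> ball (\<gamma> t) r" "\<gamma> s' \<in> ball (\<gamma> t) r"
      using \<delta> s s' by (auto simp: dist_commute dist_real_def abs_if)
    ultimately have "\<gamma> s = \<gamma> s'" using inj_onD [OF r(2)] by blast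
    then show "s = s'" using inj\<gamma> s s' by blast
  qed
  with noninj [of "\<delta> / 2"] \<delta>(1) show False by simp
qed

text \<open>
  The direction \<open>c\<close> of the shear is that of \<open>f z\<close>, so that points whose images under \<open>F\<close> lie on the line
  through \<open>0\<close> and \<open>F z\<close> have images under \<open>f\<close> on the line through \<open>0\<close> and \<open>f z\<close>. The path
  \<open>\<zeta>\<close> is the preimage of the segment from \<open>0\<close> to \<open>F z\<close> under \<open>F\<close>; it stays in the disk of radius \<open>|z|\<close>
  by starlikeness, and the intermediate value theorem for \<open>k\<close> finds the required point on it.
\<close>

lemma convex_SH0_scaled_value:
  assumes f: "f \<in> convex_SH0" and z: "cmod z < 1/6" and t: "0 \<le> t" "t \<le> 1"
  shows "of_real t * f z \<in> f ` cball 0 (cmod z)"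
proof (cases "f z = 0")
  case True
  then show ?thesis by (auto intro!: image_eqI [of _ _ z])
next
  case False
  obtain h g where inj: "inj_on f (ball 0 1)" and dec: "harmonic_decomposition (ball 0 1) f h g"
    and jac: "positive_jacobian (ball 0 1) h g" and conv: "convex (f ` ball 0 1)"
    and norm: "h 0 = 0" "deriv h 0 = 1" "g 0 = 0" "deriv g 0 = 0"
    using f by (auto simp: convex_SH0_def SH0_def)
  have hol: "h holomorphic_on ball 0 1" "g holomorphic_on ball 0 1"
    and fz: "\<And>z. z \<in> ball 0 1 \<Longrightarrow> f z = h z + cnj (g z)"
    using dec by (auto simp: harmonic_decomposition_def)
  define c where "c = sgn (f z)"
  have c: "cmod c = 1" using False by (simp add: c_def norm_sgn)
  have cf: "cnj c * f z = of_real (cmod (f z))"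
  proof -
    have "f z = of_real (cmod (f z)) * c" using False by (simp add: c_def sgn_eq)
    then have "cnj c * f z = of_real (cmod (f z)) * (c * cnj c)" by (metis mult.assoc mult.commute)
    then show ?thesis using c by (simp add: complex_norm_square [symmetric])
  qed
  define F where "F = shear c h g"
  have injF: "inj_on F (ball 0 1)"
    unfolding F_def by (rule inj_on_shear [OF inj dec jac conv c])
  have holF: "F holomorphic_on ball 0 1"
    unfolding F_def shear_def using hol by (intro holomorphic_intros)
  have F0: "F 0 = 0" using norm by (simp add: F_def shear_def)
  have "(F has_field_derivative deriv h 0 - c^2 * deriv g 0) (at 0)"
    unfolding F_def shear_def
    by (intro derivative_intros DERIV_cmult holomorphic_derivI [OF hol(1) open_ball]
        holomorphic_derivI [OF hol(2) open_ball]) auto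
  then have F1: "deriv F 0 = 1" using norm by (simp add: DERIV_imp_deriv)
  have ImF: "Im (cnj c * F u) = Im (cnj c * f u)" if "u \<in> ball 0 1" for u
    unfolding fz [OF that] F_def by (rule Im_shear [OF c])
  have sub: "ball 0 (1/6) \<subseteq> ball (0::complex) 1" by auto
  have mem: "of_real \<tau> * F z \<in> F ` cball 0 (cmod z)" if "\<tau> \<in> {0..1}" for \<tau>
    using that z univalent_starlike_disk [OF holF injF F0 F1]
    by (intro starlike_image_of_disk [where R = "1/6"] holomorphic_on_subset [OF holF sub]
        inj_on_subset [OF injF sub] F0) auto
  obtain G where G: "homeomorphism (ball 0 1) (F ` ball 0 1) F G"
    using invariance_of_domain_homeomorphism
      [OF open_ball holomorphic_on_imp_continuous_on [OF holF] _ injF] by auto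
  then have GF: "\<And>u. u \<in> ball 0 1 \<Longrightarrow> G (F u) = u" and contG: "continuous_on (F ` ball 0 1) G"
    by (auto simp: homeomorphism_def)
  define \<zeta> where "\<zeta> = (\<lambda>\<tau>::real. G (of_real \<tau> * F z))"
  have cball1: "cball 0 (cmod z) \<subseteq> ball (0::complex) 1" using z by auto
  have \<zeta>: "\<zeta> \<tau> \<in> cball 0 (cmod z)" "F (\<zeta> \<tau>) = of_real \<tau> * F z" if \<tau>: "\<tau> \<in> {0..1}" for \<tau>
  proof -
    obtain u where u: "u \<in> cball 0 (cmod z)" "of_real \<tau> * F z = F u"
      using mem [OF \<tau>] by auto
    then have "\<zeta> \<tau> = u" using GF cball1 by (auto simp: \<zeta>_def)
    with u show "\<zeta> \<tau> \<in> cball 0 (cmod z)" "F (\<zeta> \<tau>) = of_real \<tau> * F z" by auto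
  qed
  have cont\<zeta>: "continuous_on {0..1} \<zeta>"
    unfolding \<zeta>_def using mem cball1
    by (intro continuous_on_compose2 [OF contG] continuous_intros) blast
  have contf: "continuous_on (ball 0 1) f"
    using harmonic_decomposition_imp_continuous [OF dec] .
  define k where "k = (\<lambda>\<tau>. Re (cnj c * f (\<zeta> \<tau>)))"
  have "continuous_on {0..1} k"
    unfolding k_def using \<zeta> cball1
    by (intro continuous_intros continuous_on_compose2 [OF contf cont\<zeta>]) blast
  moreover have "k 0 = 0"
    using GF [of 0] F0 norm fz [of 0] by (simp add: k_def \<zeta>_def)
  moreover have "k 1 = cmod (f z)"
    using GF [of z] z by (simp add: k_def \<zeta>_def cf del: times_complex.sel)
  moreover have "0 \<le> t * cmod (f z)" "t * cmod (f z) \<le> cmod (f z)"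
    using t by (auto simp: mult_left_le_one_le)
  ultimately obtain \<tau> where \<tau>: "\<tau> \<in> {0..1}" "k \<tau> = t * cmod (f z)"
    using IVT' [of k 0 "t * cmod (f z)" 1] by auto
  have "f (\<zeta> \<tau>) = of_real t * f z"
  proof (rule unimodular_parts_eqI [OF c])
    have ct: "cnj c * (of_real t * f z) = of_real (t * cmod (f z))"
      by (simp add: mult.left_commute cf)
    show "Re (cnj c * f (\<zeta> \<tau>)) = Re (cnj c * (of_real t * f z))"
      unfolding ct using \<tau>(2) by (simp add: k_def)
    have "Im (cnj c * f (\<zeta> \<tau>)) = Im (cnj c * F (\<zeta> \<tau>))"
      using ImF \<zeta>(1) [OF \<tau>(1)] cball1 by auto
    also have "\<dots> = \<tau> * Im (cnj c * F z)"
      unfolding \<zeta>(2) [OF \<tau>(1)] by (simp add: algebra_simps)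
    also have "\<dots> = 0"
      using ImF [of z] z cf by simp
    finally show "Im (cnj c * f (\<zeta> \<tau>)) = Im (cnj c * (of_real t * f z))"
      unfolding ct by simp
  qed
  with \<zeta>(1) [OF \<tau>(1)] show ?thesis by (metis imageI)
qed

section \<open>Images of small disks\<close>

text \<open>
  In each direction \<open>d\<close> the ray from the origin leaves the domain at a distance \<open>R d\<close> and
  never returns. The remaining parts of these rays fill the complement, and they are pairwise
  disjoint because they belong to different directions.
\<close>

lemma bounded_starlike_imp_close_to_convex:
  assumes star: "starlike_domain_origin \<Omega>" and bdd: "bounded \<Omega>"
  shows "close_to_convex_domain \<Omega>"
proof -
  have op: "open \<Omega>" and dom: "planar_domain \<Omega>" and zero: "0 \<in> \<Omega>"
    and seg: "\<And>w. w \<in> \<Omega> \<Longrightarrow> closed_segment 0 w \<subseteq> \<Omega>"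
    using star by (auto simp: starlike_domain_origin_def planar_domain_def)
  have shrink: "of_real s * w \<in> \<Omega>" if "w \<in> \<Omega>" "0 \<le> s" "s \<le> 1" for s :: real and w
    using seg [OF that(1)] that(2,3) by (auto simp: closed_segment_def scaleR_conv_of_real)
  define R where "R = (\<lambda>d::complex. Inf {t. 0 \<le> t \<and> of_real t * d \<notin> \<Omega>})"
  have R: "of_real (R d) * d \<notin> \<Omega>" "R d \<ge> 0"
    "\<And>t. t \<ge> R d \<Longrightarrow> of_real t * d \<notin> \<Omega>" "\<And>t. t \<ge> 0 \<Longrightarrow> of_real t * d \<notin> \<Omega> \<Longrightarrow> R d \<le> t"
    if d: "cmod d = 1" for d
  proof -
    let ?T = "{t. 0 \<le> t \<and> of_real t * d \<notin> \<Omega>}"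
    obtain B where B: "\<And>w. w \<in> \<Omega> \<Longrightarrow> cmod w \<le> B"
      using bdd by (auto simp: bounded_iff)
    have "\<bar>B\<bar> + 1 \<in> ?T"
      using B [of "of_real (\<bar>B\<bar> + 1) * d"] d by (auto simp: norm_mult simp del: of_real_add)
    then have ne: "?T \<noteq> {}" by blast
    have "?T = {0..} \<inter> (\<lambda>t. complex_of_real t * d) -` (- \<Omega>)" by auto
    moreover have "closed \<dots>"
      using op by (intro closed_Int continuous_closed_vimage continuous_intros) auto
    ultimately have cl: "closed ?T" by (rule ssubst)
    have bb: "bdd_below ?T" by (auto intro: bdd_belowI [of _ 0])
    have "Inf ?T \<in> ?T"
      by (rule closed_contains_Inf [OF ne bb cl])
    then have "R d \<in> ?T" by (simp add: R_def)
    then show mem: "of_real (R d) * d \<notin> \<Omega>" and pos: "R d \<ge> 0" by auto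
    show "R d \<le> t" if "t \<ge> 0" "of_real t * d \<notin> \<Omega>" for t
      unfolding R_def using that bb by (intro cInf_lower) auto
    show "of_real t * d \<notin> \<Omega>" if t: "t \<ge> R d" for t
    proof
      assume "of_real t * d \<in> \<Omega>"
      show False
      proof (cases "t = 0")
        case True
        with t pos have "R d = 0" by simp
        with mem zero show False by simp
      next
        case False
        with t pos have "t > 0" by simp
        then have "of_real (R d) * d = of_real (R d / t) * (of_real t * d)" by simp
        also have "\<dots> \<in> \<Omega>"
          by (rule shrink [OF \<open>of_real t * d \<in> \<Omega>\<close>]) (use t pos \<open>t > 0\<close> in auto)
        finally show False using mem by blast
      qed
    qed
  qed
  define L where "L = (\<lambda>d. (of_real (R d) * d, d)) ` {d. cmod d = 1}"
  have half: "closed_half_line (of_real (R d) * d, d) = {of_real t * d | t. t \<ge> R d}"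
    "open_half_line (of_real (R d) * d, d) = {of_real t * d | t. t > R d}" for d
  proof -
    have e: "of_real (R d) * d + of_real t * d = of_real (R d + t) * d" for t
      by (simp add: algebra_simps)
    have ge: "{R d..} = (\<lambda>t. R d + t) ` {0..}" and gt: "{R d<..} = (\<lambda>t. R d + t) ` {0<..}"
      by (simp, auto intro: image_eqI [where x = "x - R d" for x])
    have "{of_real t * d | t. t \<ge> R d} = (\<lambda>t. of_real t * d) ` {R d..}"
      "{of_real t * d | t. t > R d} = (\<lambda>t. of_real t * d) ` {R d<..}"
      by auto
    then show "closed_half_line (of_real (R d) * d, d) = {of_real t * d | t. t \<ge> R d}"
      "open_half_line (of_real (R d) * d, d) = {of_real t * d | t. t > R d}"
      unfolding closed_half_line_def open_half_line_def unfolding ge gt image_image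
      by (auto simp add: e)
  qed
  have "\<forall>(a, d)\<in>L. cmod d = 1"
    by (auto simp: L_def)
  moreover have "- \<Omega> = (\<Union>l\<in>L. closed_half_line l)"
  proof (intro equalityI subsetI)
    fix w assume w: "w \<in> - \<Omega>"
    with zero have "w \<noteq> 0" by auto
    then have "cmod (sgn w) = 1" "w = of_real (cmod w) * sgn w"
      by (simp add: norm_sgn, simp add: sgn_eq)
    moreover from this have "R (sgn w) \<le> cmod w"
      using w by (intro R(4)) (auto)
    ultimately show "w \<in> (\<Union>l\<in>L. closed_half_line l)"
      unfolding L_def by (auto simp: half intro!: exI [of _ "sgn w"] exI [of _ "cmod w"])
  qed (auto simp: L_def half R(3))
  moreover have "pairwise (\<lambda>l m. disjnt (open_half_line l) (open_half_line m)) L"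
  proof -
    have "d = e" if "cmod d = 1" "cmod e = 1" "of_real s * d = of_real t * e" "R d < s" "R e < t"
      for d e s t
    proof -
      have "s > 0" "t > 0" using that R(2) [of d] R(2) [of e] by auto
      moreover have "cmod (of_real s * d) = cmod (of_real t * e)" using that by simp
      ultimately have "s = t" unfolding norm_mult using that(1,2) by simp
      then show ?thesis using that \<open>s > 0\<close> by simp
    qed
    then have same: "l = m" if "l \<in> L" "m \<in> L" "w \<in> open_half_line l" "w \<in> open_half_line m" for l m w
      using that unfolding L_def by (clarsimp simp: half) blast
    show ?thesis
      unfolding pairwise_def disjnt_iff using same by blast
  qed
  ultimately show ?thesis
    unfolding close_to_convex_domain_def using dom by blast
qed

lemma convex_SH0_small_disk:
  assumes f: "f \<in> convex_SH0" and \<rho>: "0 < \<rho>" "\<rho> \<le> 1/6"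
  shows "starlike_in \<rho> f" and "close_to_convex_in \<rho> f"
proof -
  obtain h g where inj1: "inj_on f (ball 0 1)" and dec: "harmonic_decomposition (ball 0 1) f h g"
    and jac: "positive_jacobian (ball 0 1) h g" and norm: "h 0 = 0" "g 0 = 0"
    using f by (auto simp: convex_SH0_def SH0_def)
  have hol: "h holomorphic_on ball 0 1" "g holomorphic_on ball 0 1"
    and fz: "\<And>z. z \<in> ball 0 1 \<Longrightarrow> f z = h z + cnj (g z)"
    using dec by (auto simp: harmonic_decomposition_def)
  have sub: "ball 0 \<rho> \<subseteq> ball (0::complex) 1" "cball 0 \<rho> \<subseteq> ball (0::complex) 1"
    using \<rho> by auto
  have contf: "continuous_on (ball 0 1) f"
    using harmonic_decomposition_imp_continuous [OF dec] .
  have inj: "inj_on f (ball 0 \<rho>)" using inj1 sub inj_on_subset by blast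
  have "harmonic_decomposition (ball 0 \<rho>) f h g" "positive_jacobian (ball 0 \<rho>) h g"
    unfolding harmonic_decomposition_def positive_jacobian_def
    using fz jac [unfolded positive_jacobian_def] sub(1)
      holomorphic_on_subset [OF hol(1) sub(1)] holomorphic_on_subset [OF hol(2) sub(1)]
    by blast+
  then have sense: "sense_preserving_harmonic_on (ball 0 \<rho>) f"
    by (auto simp: sense_preserving_harmonic_on_def)
  have contf\<rho>: "continuous_on (ball 0 \<rho>) f"
    using contf sub continuous_on_subset by blast
  have dom: "planar_domain (f ` ball 0 \<rho>)"
    unfolding planar_domain_def
    using invariance_of_domain [OF contf\<rho> open_ball inj]
      connected_continuous_image [OF contf\<rho> connected_ball] \<rho>(1)
    by simp
  have zero: "0 \<in> f ` ball 0 \<rho>"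
    using fz [of 0] norm \<rho> by (intro image_eqI [of _ _ 0]) auto
  have star: "starlike_domain_origin (f ` ball 0 \<rho>)"
    unfolding starlike_domain_origin_def
  proof (intro conjI dom zero ballI subsetI)
    fix w v assume "w \<in> f ` ball 0 \<rho>" "v \<in> closed_segment 0 w"
    then obtain z t where z: "cmod z < \<rho>" and t: "0 \<le> t" "t \<le> 1" and v: "v = of_real t * f z"
      by (auto simp: closed_segment_def scaleR_conv_of_real)
    then have "v \<in> f ` cball 0 (cmod z)"
      using \<rho> unfolding v by (intro convex_SH0_scaled_value [OF f]) auto
    then show "v \<in> f ` ball 0 \<rho>" using z by auto
  qed
  then show "starlike_in \<rho> f"
    using inj sense by (simp add: starlike_in_def)
  have "bounded (f ` cball 0 \<rho>)"
    by (intro compact_imp_bounded compact_continuous_image continuous_on_subset [OF contf sub(2)])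
      simp
  then have "bounded (f ` ball 0 \<rho>)"
    by (rule bounded_subset) (intro image_mono ball_subset_cball)
  then show "close_to_convex_in \<rho> f"
    using inj sense bounded_starlike_imp_close_to_convex [OF star]
    by (simp add: close_to_convex_in_def)
qed

section \<open>The cubic equation and the radii\<close>

text \<open>
  With \<open>x = r - 1\<close> the cubic is \<open>2 x\<^sup>3 + x + 2\<close>, which is strictly increasing; the second factor
  below is its difference quotient.
\<close>

lemma cubic_root_unique:
  fixes r s :: real
  assumes "2 * r^3 - 6 * r^2 + 7 * r - 1 = 0" "2 * s^3 - 6 * s^2 + 7 * s - 1 = 0"
  shows "r = s"
proof -
  have "(r - s) * (2 * ((r - 1)^2 + (r - 1) * (s - 1) + (s - 1)^2) + 1) = 0"
    using assms by algebra
  moreover have "(r - 1)^2 + (r - 1) * (s - 1) + (s - 1)^2 \<ge> 0"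
  proof -
    have "(r - 1)^2 + (r - 1) * (s - 1) + (s - 1)^2
        = ((r - 1) + (s - 1) / 2)^2 + 3 / 4 * (s - 1)^2"
      by (simp add: power2_eq_square field_simps)
    then show ?thesis by simp
  qed
  ultimately show ?thesis by auto
qed

text \<open>
  Cardano's formula: \<open>r_S - 1\<close> is \<open>a - b\<close> with \<open>6 a b = 1\<close> and \<open>a\<^sup>3 - b\<^sup>3 = -1\<close>, where the latter
  uses \<open>330 - 18\<^sup>2 = 6\<close>. Hence \<open>2 (a - b)\<^sup>3 + (a - b) = 2 (a\<^sup>3 - b\<^sup>3) = -2\<close>.
\<close>

lemma r_S_cubic: "2 * r_S^3 - 6 * r_S^2 + 7 * r_S - 1 = 0"
proof -
  define q where "q = sqrt (330::real)"
  have q2: "q * q = 330" and "q > 18"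
    unfolding q_def by (simp, rule real_less_rsqrt) simp
  define u where "u = root 3 (q - 18)"
  define v where "v = root 3 (6::real)"
  have u: "u > 0" "u^3 = q - 18" and v: "v > 0" "v^3 = 6"
    using \<open>q > 18\<close> by (auto simp: u_def v_def)
  have p: "6 powr (2/3) = v^2"
  proof -
    have "v = 6 powr (1/3)"
      by (simp add: v_def root_powr_inverse)
    then have "v^2 = 6 powr (1/3) * 6 powr (1/3)"
      by (simp add: power2_eq_square)
    also have "\<dots> = 6 powr (2/3)"
      by (simp add: powr_add [symmetric])
    finally show ?thesis ..
  qed
  define a b where "a = u / v^2" and "b = 1 / (v * u)"
  have r: "r_S = 1 + a - b"
    unfolding r_S_def p a_def b_def v_def u_def q_def
    by (simp only: real_root_mult) (simp add: algebra_simps)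
  have ab: "6 * (a * b) = 1"
    using u v by (simp add: a_def b_def field_simps power3_eq_cube power2_eq_square)
  have "a^3 = (q - 18) / (v^3)^2"
    unfolding a_def power_divide u(2) by (simp add: power_mult [symmetric] mult.commute)
  then have a3: "36 * a^3 = q - 18"
    using v by simp
  have "b^3 = 1 / (6 * (q - 18))"
    unfolding b_def power_divide power_mult_distrib u(2) v(2) by simp
  then have b3: "36 * b^3 = q + 18"
  proof -
    have "36 * (1 / (6 * (q - 18))) = q + 18"
      using \<open>q > 18\<close> q2 by (simp add: field_simps)
    then show ?thesis using \<open>b^3 = _\<close> by simp
  qed
  have "36 * (2 * r_S^3 - 6 * r_S^2 + 7 * r_S - 1)
     = 2 * (36 * a^3) - 2 * (36 * b^3) - 36 * (a - b) * (6 * (a * b)) + 36 * (a - b) + 72"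
    unfolding r by algebra
  also have "\<dots> = 0"
    unfolding a3 b3 ab by simp
  finally show ?thesis by simp
qed

text \<open>
  The cubic is negative at the lower and positive at the upper bound, and the
  difference quotient from \<open>r_S\<close> to either of them is positive.
\<close>

lemma r_S_bounds: "0.1648775 \<le> r_S" "r_S \<le> 0.1648785"
proof -
  have *: "2 * r_S^3 - 6 * r_S^2 + 7 * r_S - 1 - (2 * c^3 - 6 * c^2 + 7 * c - 1)
     = (r_S - c) * (2 * ((r_S - 1 + (c - 1) / 2)^2 + 3 / 4 * (c - 1)^2) + 1)" for c
    by (simp add: power2_eq_square power3_eq_cube field_simps)
  have pos: "2 * ((r_S - 1 + (c - 1) / 2)^2 + 3 / 4 * (c - 1)^2) + 1 > 0" for c :: real
    by (intro add_nonneg_pos) auto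
  have "(r_S - 0.1648775) * (2 * ((r_S - 1 + (0.1648775 - 1) / 2)^2 + 3 / 4 * (0.1648775 - 1)^2) + 1) \<ge> 0"
    unfolding * [symmetric] r_S_cubic by (simp add: power2_eq_square power3_eq_cube)
  then show "0.1648775 \<le> r_S"
    using pos [of "0.1648775"] by (simp only: zero_le_mult_iff) linarith
  have "(r_S - 0.1648785) * (2 * ((r_S - 1 + (0.1648785 - 1) / 2)^2 + 3 / 4 * (0.1648785 - 1)^2) + 1) \<le> 0"
    unfolding * [symmetric] r_S_cubic by (simp add: power2_eq_square power3_eq_cube)
  then show "r_S \<le> 0.1648785"
    using pos [of "0.1648785"] by (simp only: mult_le_0_iff) linarith
qed

theorem corollary1p10:
  shows "(\<forall>r::real. (0 < r \<and> r < 1 \<and> 2 * r^3 - 6 * r^2 + 7 * r - 1 = 0) \<longleftrightarrow> r = r_S) \<and>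
    \<bar>r_S - 0.164878\<bar> \<le> 0.0000005 \<and>
    r_S \<in> admissible_radii close_to_convex_in convex_SH0 \<and>
    r_S \<le> radius_of close_to_convex_in convex_SH0 \<and>
    r_S \<in> admissible_radii starlike_in convex_SH0 \<and>
    r_S \<le> radius_of starlike_in convex_SH0"
proof -
  have r: "0 < r_S" "r_S < 1/6" using r_S_bounds by auto
  have mem: "r_S \<in> admissible_radii close_to_convex_in convex_SH0"
    "r_S \<in> admissible_radii starlike_in convex_SH0"
    unfolding admissible_radii_def using r by (auto intro: convex_SH0_small_disk)
  have "bdd_above (admissible_radii P C)" for P and C :: "(complex \<Rightarrow> complex) set"
    by (rule bdd_aboveI [of _ 1]) (auto simp: admissible_radii_def)
  then have "r_S \<le> radius_of close_to_convex_in convex_SH0" "r_S \<le> radius_of starlike_in convex_SH0"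
    unfolding radius_of_def using mem by (simp_all add: cSup_upper)
  moreover have "(0 < s \<and> s < 1 \<and> 2 * s^3 - 6 * s^2 + 7 * s - 1 = 0) \<longleftrightarrow> s = r_S" for s :: real
  proof
    assume "s = r_S"
    then show "0 < s \<and> s < 1 \<and> 2 * s^3 - 6 * s^2 + 7 * s - 1 = 0"
      using r r_S_cubic by simp
  qed (use cubic_root_unique r_S_cubic in blast)
  moreover have "\<bar>r_S - 0.164878\<bar> \<le> 0.0000005"
    unfolding abs_le_iff using r_S_bounds by simp
  ultimately show ?thesis using mem by blast
qed

end
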